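(* Let $\mathcal{S}=\{S_i\}_{i=0}^m$ be an equicontractive iterated function system on $\mathbb{R}^d$, with associated self-similar measure given by probabilities $p_0,\dots,p_m$, satisfying the standard technical assumptions. Then the associated directed graph of $\mathcal{S}$ has a unique essential class.
   Context: Maps: $S_i(x)=rA_ix+d_i$ with $0<r<1$, $A_i$ orthogonal, $d_i\in\mathbb{R}^d$. The attractor $K$ is the unique non-empty compact set with $K=\bigcup_iS_i(K)$. For a word $\sigma=(\sigma_1,\dots,\sigma_j)$, $|\sigma|=j$, $S_\sigma=S_{\sigma_1}\circ\cdots\circ S_{\sigma_j}$; $S_\epsilon=\mathrm{Id}$ for the empty word. The probabilities satisfy $p_i>0$, $\sum_ip_i=1$, and $\mu$ is the unique Borel probability measure with $\mu(A)=\sum_ip_i\,\mu(S_i^{-1}(A))$. Net intervals. Write $Q=[-1/2,1/2]^d$, $V=(-1/2,1/2)^d$. For $n\ge0$ and $x\in Q\setminus\bigcup_{|\sigma|=n}S_\sigma(\partial Q)$ put $$\Delta_n(x)=\Big(\bigcap_{|\sigma|=n,\ x\in S_\sigma(V)}S_\sigma(Q)\Big)\setminus\Big(\bigcup_{|\sigma|=n,\ x\notin S_\sigma(V)}S_\sigma(V)\Big);$$ it is a net interval of level $n$ if $\operatorname{int}(\Delta_n(x))\cap K\ne\emptyset$. $\mathcal{F}_n$ is the collection of net intervals of level $n$. For $\Delta_1\in\mathcal{F}_n$ and $\Delta_2\in\mathcal{F}_{n+1}$ with $\Delta_2\subset\Delta_1$, $\Delta_2$ is called a child of $\Delta_1$.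 Neighbor sets. For $\Delta\in\mathcal{F}_n$ let $L$ be the largest positive real such that $L[0,1]^d+e\subset\Delta$ for some $e\in\mathbb{R}^d$, let $a$ be the lexicographically smallest such $e$, and let $T_\Delta(x)=Lx+a$. The neighbor set of $\Delta$ is $V(\Delta)=\{T_\Delta^{-1}\circ S_\sigma:|\sigma|=n,\ S_\sigma(Q)\supset\Delta\}$. The finite neighbor condition (FNC) holds if there are only finitely many distinct neighbor sets over all $n$ and $\Delta\in\mathcal{F}_n$. Standard technical assumptions: (i) $\mathcal{S}$ satisfies the FNC; (ii) $K=Q$; (iii) with $p_{\min}=\min_ip_i$, $p_j=p_{\min}$ whenever $S_j(Q)\cap\partial Q\neq\emptyset$; (iv) all contraction ratios are equal. Associated graph. Its vertices are the normalized net intervals, where a net interval is identified with its neighbor set; there is a directed edge from one vertex to another if there are net intervals $\Delta_1,\Delta_2$ representing them, respectively, such that $\Delta_2$ is a child of $\Delta_1$. A set $\mathscr{L}$ of vertices is a loop class (strongly connected component) if for all $A,B\in\mathscr{L}$ there is a path from $A$ to $B$ staying in $\mathscr{L}$. A loop class is maximal if it is not properly contained in another loop class. A maximal loop class is essential if all children of its members remain in the loop class.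
   Formalization: "Child" is read with the interior of Δ₂ contained in Δ₁ instead of Δ₂ ⊂ Δ₁, since net intervals can keep lower-dimensional face remnants outside the parent; with plain inclusion some net intervals have no child and uniqueness of the essential class fails. *)

theory Defs
  imports "HOL-Probability.Probability"
begin

text \<open>
  Euclidean \<open>d\<close>-space is \<^typ>\<open>real ^ 'n\<close>; the linear order on the index type \<open>'n\<close> is only used
  to speak about the lexicographic order.  An iterated function system is a family
  \<open>S 0, \<dots>, S m\<close>, and words are lists over \<open>{..m}\<close>.
\<close>

definition Qcube :: "(real ^ 'n) set" where
  "Qcube = cbox (\<chi> i. - 1/2) (\<chi> i. 1/2)"

definition Vcube :: "(real ^ 'n) set" where
  "Vcube = box (\<chi> i. - 1/2) (\<chi> i. 1/2)"

definition words :: "nat \<Rightarrow> nat \<Rightarrow> nat list set" where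
  "words m n = {\<sigma>. length \<sigma> = n \<and> set \<sigma> \<subseteq> {..m}}"

fun word_map :: "(nat \<Rightarrow> 'a \<Rightarrow> 'a) \<Rightarrow> nat list \<Rightarrow> 'a \<Rightarrow> 'a" where
  "word_map S [] = id"
| "word_map S (i # \<sigma>) = S i \<circ> word_map S \<sigma>"

definition is_attractor :: "nat \<Rightarrow> (nat \<Rightarrow> 'a \<Rightarrow> 'a) \<Rightarrow> ('a::topological_space) set \<Rightarrow> bool" where
  "is_attractor m S K \<longleftrightarrow> K \<noteq> {} \<and> compact K \<and> K = (\<Union>i\<le>m. S i ` K)"

definition is_self_similar_measure ::
  "nat \<Rightarrow> (nat \<Rightarrow> 'a \<Rightarrow> 'a) \<Rightarrow> (nat \<Rightarrow> real) \<Rightarrow> ('a::topological_space) measure \<Rightarrow> bool" where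
  "is_self_similar_measure m S p \<mu> \<longleftrightarrow>
     prob_space \<mu> \<and> sets \<mu> = sets borel \<and>
     (\<forall>B \<in> sets borel. measure \<mu> B = (\<Sum>i\<le>m. p i * measure \<mu> (S i -` B)))"


subsection \<open>Net intervals\<close>

definition net_cell ::
  "nat \<Rightarrow> (nat \<Rightarrow> real ^ 'n \<Rightarrow> real ^ 'n) \<Rightarrow> nat \<Rightarrow> real ^ 'n \<Rightarrow> (real ^ 'n) set" where
  "net_cell m S n x =
     (\<Inter>\<sigma> \<in> {\<sigma> \<in> words m n. x \<in> word_map S \<sigma> ` Vcube}. word_map S \<sigma> ` Qcube)
     - (\<Union>\<sigma> \<in> {\<sigma> \<in> words m n. x \<notin> word_map S \<sigma> ` Vcube}. word_map S \<sigma> ` Vcube)"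

definition net_intervals ::
  "nat \<Rightarrow> (nat \<Rightarrow> real ^ 'n \<Rightarrow> real ^ 'n) \<Rightarrow> (real ^ 'n) set \<Rightarrow> nat \<Rightarrow> (real ^ 'n) set set" where
  "net_intervals m S K n =
     {net_cell m S n x | x.
        x \<in> Qcube - (\<Union>\<sigma> \<in> words m n. word_map S \<sigma> ` frontier Qcube) \<and>
        interior (net_cell m S n x) \<inter> K \<noteq> {}}"

text \<open>
  The sets \<^const>\<open>net_cell\<close> need not be the closures of their interiors: removing the open cubes
  \<open>S\<^sub>\<sigma>(V)\<close> can leave lower-dimensional remnants, namely pieces of the common faces of removed
  cubes or of the faces of the intersection, and these may lie outside the cell of the previous
  level.  The containment of a child in its parent is therefore understood up to such remnants,
  that is, for the interior of the child.  Plain inclusion implies this relation, and the two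
  agree if the child is the closure of its interior, since every net interval is closed.
  With plain inclusion a net interval may have no child at all.
\<close>

definition is_child :: "(real ^ 'n) set \<Rightarrow> (real ^ 'n) set \<Rightarrow> bool" where
  "is_child \<Delta>\<^sub>2 \<Delta>\<^sub>1 \<longleftrightarrow> interior \<Delta>\<^sub>2 \<subseteq> \<Delta>\<^sub>1"


subsection \<open>Neighbor sets\<close>

definition lex_le :: "real ^ 'n::{finite,linorder} \<Rightarrow> real ^ 'n::{finite,linorder} \<Rightarrow> bool" where
  "lex_le x y \<longleftrightarrow> x = y \<or> (\<exists>i. x $ i < y $ i \<and> (\<forall>j<i. x $ j = y $ j))"

definition cube_at :: "real \<Rightarrow> real ^ 'n \<Rightarrow> (real ^ 'n) set" where
  "cube_at L e = (\<lambda>x. L *\<^sub>R x + e) ` cbox 0 1"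

text \<open>
  Net intervals are compact with non-empty interior, so the maximum and the lexicographic minimum
  below exist for them.
\<close>

definition norm_length :: "(real ^ 'n) set \<Rightarrow> real" where
  "norm_length \<Delta> = (GREATEST L. 0 < L \<and> (\<exists>e. cube_at L e \<subseteq> \<Delta>))"

definition norm_corner :: "(real ^ 'n::{finite,linorder}) set \<Rightarrow> real ^ 'n::{finite,linorder}" where
  "norm_corner \<Delta> = (THE a. cube_at (norm_length \<Delta>) a \<subseteq> \<Delta> \<and>
     (\<forall>e. cube_at (norm_length \<Delta>) e \<subseteq> \<Delta> \<longrightarrow> lex_le a e))"

definition norm_map :: "(real ^ 'n::{finite,linorder}) set \<Rightarrow> real ^ 'n::{finite,linorder} \<Rightarrow> real ^ 'n::{finite,linorder}" where
  "norm_map \<Delta> x = norm_length \<Delta> *\<^sub>R x + norm_corner \<Delta>"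

text \<open>
  The level \<open>n\<close> is an argument because the same set may be a net interval of several levels.
\<close>

definition neighbor_set ::
  "nat \<Rightarrow> (nat \<Rightarrow> real ^ 'n::{finite,linorder} \<Rightarrow> real ^ 'n::{finite,linorder}) \<Rightarrow> nat \<Rightarrow> (real ^ 'n::{finite,linorder}) set
     \<Rightarrow> (real ^ 'n::{finite,linorder} \<Rightarrow> real ^ 'n::{finite,linorder}) set" where
  "neighbor_set m S n \<Delta> =
     {inv (norm_map \<Delta>) \<circ> word_map S \<sigma> | \<sigma>. \<sigma> \<in> words m n \<and> \<Delta> \<subseteq> word_map S \<sigma> ` Qcube}"

definition graph_verts ::
  "nat \<Rightarrow> (nat \<Rightarrow> real ^ 'n::{finite,linorder} \<Rightarrow> real ^ 'n::{finite,linorder}) \<Rightarrow> (real ^ 'n::{finite,linorder}) set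
     \<Rightarrow> (real ^ 'n::{finite,linorder} \<Rightarrow> real ^ 'n::{finite,linorder}) set set" where
  "graph_verts m S K = {neighbor_set m S n \<Delta> | n \<Delta>. \<Delta> \<in> net_intervals m S K n}"

definition graph_edges ::
  "nat \<Rightarrow> (nat \<Rightarrow> real ^ 'n::{finite,linorder} \<Rightarrow> real ^ 'n::{finite,linorder}) \<Rightarrow> (real ^ 'n::{finite,linorder}) set
     \<Rightarrow> (real ^ 'n::{finite,linorder} \<Rightarrow> real ^ 'n::{finite,linorder}) set rel" where
  "graph_edges m S K =
     {(neighbor_set m S n \<Delta>\<^sub>1, neighbor_set m S (Suc n) \<Delta>\<^sub>2) | n \<Delta>\<^sub>1 \<Delta>\<^sub>2.
        \<Delta>\<^sub>1 \<in> net_intervals m S K n \<and> \<Delta>\<^sub>2 \<in> net_intervals m S K (Suc n) \<and> is_child \<Delta>\<^sub>2 \<Delta>\<^sub>1}"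

definition finite_neighbor_condition ::
  "nat \<Rightarrow> (nat \<Rightarrow> real ^ 'n::{finite,linorder} \<Rightarrow> real ^ 'n::{finite,linorder}) \<Rightarrow> (real ^ 'n::{finite,linorder}) set \<Rightarrow> bool" where
  "finite_neighbor_condition m S K \<longleftrightarrow>
     finite {neighbor_set m S n \<Delta> | n \<Delta>. \<Delta> \<in> net_intervals m S K n}"

text \<open>
  Equality of the contraction ratios, which is also a standard technical assumption, is expressed
  by the form of the maps of an equicontractive system: one \<open>r\<close> serves for all of them.
\<close>

definition standard_technical_assumptions ::
  "nat \<Rightarrow> (nat \<Rightarrow> real ^ 'n::{finite,linorder} \<Rightarrow> real ^ 'n::{finite,linorder}) \<Rightarrow> (nat \<Rightarrow> real) \<Rightarrow> (real ^ 'n::{finite,linorder}) set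
     \<Rightarrow> bool" where
  "standard_technical_assumptions m S p K \<longleftrightarrow>
     finite_neighbor_condition m S K \<and>
     K = Qcube \<and>
     (\<forall>j\<le>m. S j ` Qcube \<inter> frontier Qcube \<noteq> {} \<longrightarrow> p j = Min (p ` {..m}))"


subsection \<open>Loop classes\<close>

definition loop_class :: "'v set \<Rightarrow> 'v rel \<Rightarrow> 'v set \<Rightarrow> bool" where
  "loop_class X E C \<longleftrightarrow> C \<subseteq> X \<and> (\<forall>A\<in>C. \<forall>B\<in>C. (A, B) \<in> (E \<inter> C \<times> C)\<^sup>*)"

definition maximal_loop_class :: "'v set \<Rightarrow> 'v rel \<Rightarrow> 'v set \<Rightarrow> bool" where
  "maximal_loop_class X E C \<longleftrightarrow> loop_class X E C \<and> \<not> (\<exists>C'. loop_class X E C' \<and> C \<subset> C')"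

definition essential_class :: "'v set \<Rightarrow> 'v rel \<Rightarrow> 'v set \<Rightarrow> bool" where
  "essential_class X E C \<longleftrightarrow>
     maximal_loop_class X E C \<and> (\<forall>A\<in>C. \<forall>B. (A, B) \<in> E \<longrightarrow> B \<in> C)"

end

theory Submission
  imports Defs
begin

text \<open>
  It suffices to find a vertex that is reachable from every vertex.  Take a net interval
  \<open>\<Delta>\<^sub>0\<close> with the maximal number of neighbors.  Since \<open>K = Q\<close>, every net interval
  \<open>\<Delta>\<close> contains some \<open>S\<^sub>\<sigma>(Q)\<close> in its interior, and by the finite neighbor condition a power
  \<open>h\<close> of \<open>S\<^sub>\<sigma>\<close> is a homothety, without any rotation.  The copy of \<open>\<Delta>\<^sub>0\<close> under \<open>h\<close> has at
  least as many neighbors as \<open>\<Delta>\<^sub>0\<close>, hence no others by maximality.  So it agrees, up to remnants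
  without interior, with a net interval that descends from \<open>\<Delta>\<close> and has the neighbor set of
  \<open>\<Delta>\<^sub>0\<close>.
\<close>

section \<open>Essential classes of directed graphs\<close>

text \<open>Edges cannot leave a closed set, so a path that starts in it never does. Loop classes
  ask for paths inside the class, and this supplies them.\<close>

lemma rtrancl_in_closed:
  assumes "\<And>a b. a \<in> C \<Longrightarrow> (a, b) \<in> E \<Longrightarrow> b \<in> C" and "x \<in> C" and "(x, y) \<in> E\<^sup>*"
  shows "y \<in> C \<and> (x, y) \<in> (E \<inter> C \<times> C)\<^sup>*"
  using assms(3)
proof (induction rule: rtrancl_induct)
  case base
  then show ?case using assms(2) by simp
next
  case (step y z)
  then have "(y, z) \<in> E \<inter> C \<times> C" using assms(1) by auto
  then show ?case using step by (meson IntD2 SigmaD2 rtrancl.rtrancl_into_rtrancl)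
qed

text \<open>The vertices reachable from \<open>v\<close> form an essential class, since each of them
  leads back to \<open>v\<close>. Any essential class is non-empty and closed, hence contains
  \<open>v\<close> and all that is reachable from it; maximality of the latter set forces
  equality.\<close>

lemma ex1_essential_class:
  assumes v: "v \<in> X" and E: "E \<subseteq> X \<times> X" and reach: "\<And>w. w \<in> X \<Longrightarrow> (w, v) \<in> E\<^sup>*"
  shows "\<exists>!C. essential_class X E C"
proof
  define C where "C = {w. (v, w) \<in> E\<^sup>*}"
  have closed: "b \<in> C" if "a \<in> C" "(a, b) \<in> E" for a b
    using that by (auto simp: C_def)
  have CX: "C \<subseteq> X"
    using rtrancl_in_closed[of X E v] v E by (auto simp: C_def)
  have loop: "loop_class X E C"
    unfolding loop_class_def
  proof (intro conjI ballI CX)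
    fix a b assume ab: "a \<in> C" "b \<in> C"
    then have "(a, b) \<in> E\<^sup>*"
      using reach[of a] CX by (auto simp: C_def intro: rtrancl_trans)
    then show "(a, b) \<in> (E \<inter> C \<times> C)\<^sup>*"
      using rtrancl_in_closed[of C E a b] closed ab by blast
  qed
  have vC: "v \<in> C" by (simp add: C_def)
  have maxi: "C' = C" if C': "loop_class X E C'" "C \<subseteq> C'" for C'
  proof -
    have "w \<in> C" if "w \<in> C'" for w
    proof -
      have "(v, w) \<in> (E \<inter> C' \<times> C')\<^sup>*"
        using C' that vC unfolding loop_class_def by blast
      then have "(v, w) \<in> E\<^sup>*" by (rule rtrancl_mono[THEN subsetD, rotated]) auto
      then show ?thesis by (simp add: C_def)
    qed
    then show ?thesis using C' by blast
  qed
  show "essential_class X E C"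
    unfolding essential_class_def maximal_loop_class_def using loop closed maxi by blast
  fix C' assume C': "essential_class X E C'"
  then have loop': "loop_class X E C'" and clos': "\<And>a b. a \<in> C' \<Longrightarrow> (a, b) \<in> E \<Longrightarrow> b \<in> C'"
    and max': "\<not> (\<exists>D. loop_class X E D \<and> C' \<subset> D)"
    unfolding essential_class_def maximal_loop_class_def by auto
  \<comment> \<open>The empty set is a loop class too; the one-point class shows that it is not
    maximal.\<close>
  have "loop_class X E {v}" using v by (simp add: loop_class_def)
  then have "C' \<noteq> {}" using max' by blast
  then obtain a where a: "a \<in> C'" by blast
  then have "a \<in> X" using loop' by (auto simp: loop_class_def)
  then have "v \<in> C'" using rtrancl_in_closed[of C' E a v] clos' a reach by blast
  have "w \<in> C'" if "w \<in> C" for w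
    using rtrancl_in_closed[OF clos' \<open>v \<in> C'\<close>] that by (simp add: C_def)
  then have "C \<subseteq> C'" by (rule subsetI)
  then show "C' = C" by (rule maxi[OF loop'])
qed

section \<open>The normalization of a cell\<close>

lemma lex_le_antisym:
  assumes "lex_le x y" "lex_le y x"
  shows "x = y"
proof (rule ccontr)
  assume "x \<noteq> y"
  then obtain i j where i: "x $ i < y $ i" "\<forall>k<i. x $ k = y $ k"
    and j: "y $ j < x $ j" "\<forall>k<j. y $ k = x $ k"
    using assms unfolding lex_le_def by auto
  then show False by (cases i j rule: linorder_cases) auto
qed

text \<open>The coordinates are minimized one after another: the minimum of the first one is
  attained by compactness, and the slice on which it is attained is again compact. Comparing only
  the coordinates in \<open>xs\<close> makes the induction possible.\<close>

lemma compact_lex_min_on_list: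
  fixes D :: "(real ^ 'n::{finite,linorder}) set"
  assumes "compact D" "D \<noteq> {}" "sorted_wrt (<) xs"
  shows "\<exists>a\<in>D. \<forall>e\<in>D. (\<forall>i\<in>set xs. a $ i = e $ i) \<or>
     (\<exists>i\<in>set xs. a $ i < e $ i \<and> (\<forall>j\<in>set xs. j < i \<longrightarrow> a $ j = e $ j))"
  using assms
proof (induction xs arbitrary: D)
  case Nil
  then show ?case by auto
next
  case (Cons k xs)
  have "continuous_on D (\<lambda>x. x $ k)" by (intro continuous_intros)
  from continuous_attains_inf[OF Cons.prems(1,2) this]
  obtain c where c: "c \<in> D" "\<forall>y\<in>D. c $ k \<le> y $ k" by blast
  define D' where "D' = D \<inter> {x. x $ k = c $ k}"
  have "closed {x. x $ k = c $ k}"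
    by (intro closed_Collect_eq continuous_intros)
  then have "compact D'" unfolding D'_def using Cons.prems(1) by (rule compact_Int_closed[rotated])
  moreover have "D' \<noteq> {}" using c by (auto simp: D'_def)
  ultimately obtain a where a: "a \<in> D'" "\<forall>e\<in>D'. (\<forall>i\<in>set xs. a $ i = e $ i) \<or>
     (\<exists>i\<in>set xs. a $ i < e $ i \<and> (\<forall>j\<in>set xs. j < i \<longrightarrow> a $ j = e $ j))"
    using Cons.IH[of D'] Cons.prems(3) by auto
  have kmin: "\<forall>i\<in>set xs. k < i" using Cons.prems(3) by simp
  have ak: "a $ k = c $ k" "a \<in> D" using a(1) by (auto simp: D'_def)
  show ?case
  proof (intro bexI[of _ a] ballI ak(2))
    fix e assume e: "e \<in> D"
    show "(\<forall>i\<in>set (k # xs). a $ i = e $ i) \<or>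
       (\<exists>i\<in>set (k # xs). a $ i < e $ i \<and> (\<forall>j\<in>set (k # xs). j < i \<longrightarrow> a $ j = e $ j))"
    proof (cases "e $ k = c $ k")
      case True
      then have "e \<in> D'" using e by (simp add: D'_def)
      then show ?thesis using a(2) ak True by auto
    next
      case False
      then have "a $ k < e $ k" using c(2) e ak by force
      then show ?thesis using kmin by (auto dest: less_asym)
    qed
  qed
qed

lemma compact_ex1_lex_min:
  fixes D :: "(real ^ 'n::{finite,linorder}) set"
  assumes "compact D" "D \<noteq> {}"
  shows "\<exists>!a. a \<in> D \<and> (\<forall>e. e \<in> D \<longrightarrow> lex_le a e)"
proof -
  have "sorted_wrt (<) (sorted_list_of_set (UNIV :: 'n set))" by simp
  from compact_lex_min_on_list[OF assms this] obtain a where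
    a: "a \<in> D" "\<forall>e\<in>D. (\<forall>i. a $ i = e $ i) \<or> (\<exists>i. a $ i < e $ i \<and> (\<forall>j. j < i \<longrightarrow> a $ j = e $ j))"
    by auto
  then have "\<forall>e\<in>D. lex_le a e" unfolding lex_le_def by (auto simp: vec_eq_iff)
  then show ?thesis using a(1) lex_le_antisym by blast
qed

section \<open>Largest axis-parallel cubes in compact sets\<close>

lemma cube_at_eq_cbox:
  fixes e :: "real ^ 'n"
  assumes "0 \<le> L"
  shows "cube_at L e = cbox e (e + L *\<^sub>R 1)"
proof -
  have "cbox 0 1 \<noteq> ({} :: (real ^ 'n) set)"
    by (simp add: interval_ne_empty_cart)
  then show ?thesis unfolding cube_at_def
    using image_affinity_cbox[of L e "0::real^'n" 1] assms by (simp add: add.commute)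
qed

text \<open>A cube is the closure of its open box. Hence the normalization of a closed set depends
  on its interior alone, and remnants without interior do not affect it.\<close>

lemma cube_at_subset_iff_interior:
  fixes \<Delta> :: "(real ^ 'n) set"
  assumes "closed \<Delta>" "0 < L"
  shows "cube_at L e \<subseteq> \<Delta> \<longleftrightarrow> box e (e + L *\<^sub>R 1) \<subseteq> interior \<Delta>"
proof -
  have ne: "box e (e + L *\<^sub>R 1) \<noteq> {}"
    using assms by (simp add: interval_eq_empty_cart)
  show ?thesis
  proof
    assume "cube_at L e \<subseteq> \<Delta>"
    then show "box e (e + L *\<^sub>R 1) \<subseteq> interior \<Delta>"
      using assms interior_mono[of "cube_at L e" \<Delta>] by (simp add: cube_at_eq_cbox)
  next
    assume "box e (e + L *\<^sub>R 1) \<subseteq> interior \<Delta>"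
    then have "closure (box e (e + L *\<^sub>R 1)) \<subseteq> \<Delta>"
      using assms interior_subset closure_minimal by blast
    then show "cube_at L e \<subseteq> \<Delta>" using assms ne by (simp add: cube_at_eq_cbox)
  qed
qed

lemma closed_cube_at_params:
  fixes \<Delta> :: "(real ^ 'n) set"
  assumes "closed \<Delta>"
  shows "closed {z. cube_at (fst z) (snd z) \<subseteq> \<Delta>}"
proof -
  have "{z. cube_at (fst z) (snd z) \<subseteq> \<Delta>} = (\<Inter>u\<in>cbox 0 1. (\<lambda>z. fst z *\<^sub>R u + snd z) -` \<Delta>)"
    by (auto simp: cube_at_def)
  moreover have "closed ((\<lambda>z. fst z *\<^sub>R u + snd z) -` \<Delta>)" for u
    using assms by (intro closed_vimage continuous_intros)
  ultimately show ?thesis by auto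
qed

text \<open>The side length is a continuous function of the pair of side and corner, and it is
  maximized over a compact set of such pairs.\<close>

lemma norm_length_attained:
  fixes \<Delta> :: "(real ^ 'n) set"
  assumes comp: "compact \<Delta>" and int: "interior \<Delta> \<noteq> {}"
  obtains L where "norm_length \<Delta> = L" "0 < L" "\<exists>e. cube_at L e \<subseteq> \<Delta>"
    "\<And>L'. 0 < L' \<Longrightarrow> \<exists>e. cube_at L' e \<subseteq> \<Delta> \<Longrightarrow> L' \<le> L"
proof -
  obtain x e where x: "0 < e" "ball x e \<subseteq> \<Delta>" using int by (auto simp: mem_interior)
  \<comment> \<open>The norm of the all-ones vector is the diagonal of the unit cube, so a cube of
    side \<open>L0\<close> with corner \<open>x\<close> fits into the ball.\<close>
  define L0 where "L0 = e / (2 * (norm (1::real^'n) + 1))"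
  have L0: "0 < L0" using x by (auto simp: L0_def intro!: divide_pos_pos add_nonneg_pos)
  have "cube_at L0 x \<subseteq> ball x e"
  proof (auto simp: cube_at_def dist_norm)
    fix u :: "real ^ 'n" assume "u \<in> cbox 0 1"
    then have "norm u \<le> norm (1::real^'n)"
      by (intro norm_le_componentwise_cart) (auto simp: mem_box_cart)
    then have "L0 * norm u \<le> L0 * (norm (1::real^'n) + 1)" using L0 by (intro mult_left_mono) auto
    also have "\<dots> < e"
    proof -
      have "norm (1::real^'n) + 1 > 0" by (simp add: add_nonneg_pos)
      then have "L0 * (norm (1::real^'n) + 1) = e / 2" unfolding L0_def by (simp only: times_divide_eq_left) (metis less_irrefl mult.commute mult_divide_mult_cancel_left)
      then show ?thesis using x by simp
    qed
    finally show "\<bar>L0\<bar> * norm u < e" using L0 by simp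
  qed
  then have c0: "cube_at L0 x \<subseteq> \<Delta>" using x by blast
  \<comment> \<open>The cutoff at \<open>L0\<close> replaces the condition that the side be
    positive, which is not closed. Shorter sides cannot be maximal.\<close>
  define Z where "Z = {z. cube_at (fst z) (snd z) \<subseteq> \<Delta>} \<inter> {z. L0 \<le> fst z}"
  obtain B where B: "\<And>x. x \<in> \<Delta> \<Longrightarrow> norm x \<le> B"
    using compact_imp_bounded[OF comp] by (auto simp: bounded_iff)
  have n1: "1 \<le> norm (1::real^'n)"
    by (metis component_le_norm_cart abs_one one_index)
  \<comment> \<open>Two opposite corners of the cube lie in \<Delta>, which bounds the side by the
    size of \<Delta>.\<close>
  have inZ: "L \<le> 2 * B \<and> e \<in> \<Delta>" if "cube_at L e \<subseteq> \<Delta>" "0 < L" for L and e :: "real ^ 'n"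
  proof -
    have "e \<in> cube_at L e" "L *\<^sub>R 1 + e \<in> cube_at L e"
      unfolding cube_at_def by (force simp: mem_box_cart image_iff)+
    then have *: "e \<in> \<Delta>" "L *\<^sub>R 1 + e \<in> \<Delta>" using that by auto
    have "L \<le> norm (L *\<^sub>R (1::real^'n))" using that n1 by simp
    also have "\<dots> \<le> norm (L *\<^sub>R 1 + e) + norm e"
      by (metis add_diff_cancel_right' norm_triangle_ineq4)
    also have "\<dots> \<le> 2 * B" using B[OF *(1)] B[OF *(2)] by simp
    finally show ?thesis using * by simp
  qed
  have "closed Z" unfolding Z_def
    by (intro closed_Int closed_cube_at_params compact_imp_closed comp closed_Collect_le continuous_intros)
  moreover have "Z \<subseteq> {0..2*B} \<times> \<Delta>" using inZ L0 by (force simp: Z_def)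
  moreover have "bounded ({0..2*B} \<times> \<Delta>)"
    using comp by (intro bounded_Times) (auto intro: compact_imp_bounded)
  ultimately have "compact Z" using bounded_subset compact_eq_bounded_closed by blast
  moreover have "(L0, x) \<in> Z" using c0 by (simp add: Z_def)
  moreover have "continuous_on Z fst" by (intro continuous_intros)
  ultimately obtain z where z: "z \<in> Z" "\<And>w. w \<in> Z \<Longrightarrow> fst w \<le> fst z"
    using continuous_attains_sup[of Z fst] by blast
  have max: "L' \<le> fst z" if "cube_at L' e \<subseteq> \<Delta>" for L' e
    using z(2)[of "(L', e)"] that z(1) by (cases "L0 \<le> L'") (auto simp: Z_def)
  have ex: "0 < fst z \<and> (\<exists>e. cube_at (fst z) e \<subseteq> \<Delta>)" using z(1) L0 by (auto simp: Z_def)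
  have "norm_length \<Delta> = fst z"
    unfolding norm_length_def by (rule Greatest_equality) (use ex max in auto)
  then show ?thesis using that ex max by blast
qed

lemma norm_length_pos:
  fixes \<Delta> :: "(real ^ 'n) set"
  assumes "compact \<Delta>" "interior \<Delta> \<noteq> {}"
  shows "0 < norm_length \<Delta>"
  using norm_length_attained[OF assms] by metis

text \<open>The admissible corners form a slice of the closed parameter set and lie in \<Delta>, so
  they form a compact set.\<close>

lemma norm_corner_unique:
  fixes \<Delta> :: "(real ^ 'n::{finite,linorder}) set"
  assumes "compact \<Delta>" "interior \<Delta> \<noteq> {}"
  shows "\<exists>!a. cube_at (norm_length \<Delta>) a \<subseteq> \<Delta> \<and>
     (\<forall>e. cube_at (norm_length \<Delta>) e \<subseteq> \<Delta> \<longrightarrow> lex_le a e)"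
proof -
  let ?D = "{e. cube_at (norm_length \<Delta>) e \<subseteq> \<Delta>}"
  have "?D = Pair (norm_length \<Delta>) -` {z. cube_at (fst z) (snd z) \<subseteq> \<Delta>}" by auto
  then have "closed ?D"
    by (simp only:) (intro closed_vimage closed_cube_at_params compact_imp_closed assms(1) continuous_intros)
  moreover have "?D \<subseteq> \<Delta>"
  proof
    fix e assume "e \<in> ?D"
    moreover have "e \<in> cube_at (norm_length \<Delta>) e"
      unfolding cube_at_def by (force simp: mem_box_cart image_iff)
    ultimately show "e \<in> \<Delta>" by auto
  qed
  ultimately have "compact ?D"
    using assms(1) bounded_subset compact_eq_bounded_closed by metis
  moreover have "?D \<noteq> {}" using norm_length_attained[OF assms] by auto
  ultimately show ?thesis using compact_ex1_lex_min[of ?D] by simp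
qed

lemma bij_norm_map:
  assumes "compact \<Delta>" "interior \<Delta> \<noteq> {}"
  shows "bij (norm_map \<Delta>)"
proof (rule o_bij)
  let ?g = "\<lambda>y. (1 / norm_length \<Delta>) *\<^sub>R (y - norm_corner \<Delta>)"
  show "?g \<circ> norm_map \<Delta> = id" "norm_map \<Delta> \<circ> ?g = id"
    using norm_length_pos[OF assms] by (auto simp: fun_eq_iff norm_map_def)
qed

text \<open>A homothety with positive ratio maps axis-parallel cubes to axis-parallel cubes and
  respects the lexicographic order, so it carries the largest cube and its corner along. Only the
  interiors have to correspond, which is all that is known about copied cells.\<close>

lemma norm_map_homothety:
  fixes \<Delta> \<Delta>' :: "(real ^ 'n::{finite,linorder}) set"
  assumes \<Delta>: "compact \<Delta>" "interior \<Delta> \<noteq> {}" and \<Delta>': "compact \<Delta>'"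
    and c: "0 < c" and h: "\<And>x. h x = c *\<^sub>R x + b"
    and int: "interior \<Delta>' = h ` interior \<Delta>"
  shows "norm_map \<Delta>' = h \<circ> norm_map \<Delta>"
proof -
  have inj: "inj h" using c by (auto simp: inj_def h)
  have int': "interior \<Delta>' \<noteq> {}" using \<Delta>(2) int by simp
  have cube: "cube_at (c * L) (h e) \<subseteq> \<Delta>' \<longleftrightarrow> cube_at L e \<subseteq> \<Delta>" if "0 < L" for L e
  proof -
    have "h ` box e (e + L *\<^sub>R 1) = box (h e) (h e + (c * L) *\<^sub>R 1)"
    proof -
      have "h ` box e (e + L *\<^sub>R 1) = (\<lambda>x. c *\<^sub>R x + b) ` box e (e + L *\<^sub>R 1)" by (simp add: h)
      also have "\<dots> = box (h e) (h e + (c * L) *\<^sub>R 1)"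
      proof (intro set_eqI iffI)
        fix y assume "y \<in> box (h e) (h e + (c * L) *\<^sub>R 1)"
        then have "(1/c) *\<^sub>R (y - b) \<in> box e (e + L *\<^sub>R 1)"
          using c by (auto simp: mem_box_cart h field_simps)
        then show "y \<in> (\<lambda>x. c *\<^sub>R x + b) ` box e (e + L *\<^sub>R 1)"
          using c by (intro image_eqI[of _ _ "(1/c) *\<^sub>R (y - b)"]) auto
      next
        fix y assume "y \<in> (\<lambda>x. c *\<^sub>R x + b) ` box e (e + L *\<^sub>R 1)"
        then obtain x where "y = c *\<^sub>R x + b" "x \<in> box e (e + L *\<^sub>R 1)" by blast
        then have x: "y = c *\<^sub>R x + b" "\<And>i. e $ i < x $ i" "\<And>i. x $ i < e $ i + L"
          by (auto simp: mem_box_cart)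
        have "c * x $ i < c * e $ i + c * L" for i
          using mult_strict_left_mono[OF x(3) c] by (simp add: distrib_left)
        then show "y \<in> box (h e) (h e + (c * L) *\<^sub>R 1)"
          using x c by (simp add: mem_box_cart h)
      qed
      finally show ?thesis .
    qed
    then have "cube_at (c * L) (h e) \<subseteq> \<Delta>' \<longleftrightarrow> h ` box e (e + L *\<^sub>R 1) \<subseteq> h ` interior \<Delta>"
      using cube_at_subset_iff_interior[of \<Delta>' "c * L" "h e"] \<Delta>' c that int
      by (simp add: compact_imp_closed)
    also have "\<dots> \<longleftrightarrow> cube_at L e \<subseteq> \<Delta>"
      using cube_at_subset_iff_interior[of \<Delta> L e] \<Delta> that inj
      by (simp add: compact_imp_closed inj_image_subset_iff)
    finally show ?thesis .
  qed
  have surj: "\<exists>e. y = h e" for y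
    by (rule exI[of _ "(1/c) *\<^sub>R (y - b)"]) (use c in \<open>simp add: h\<close>)
  obtain L where L: "norm_length \<Delta> = L" "0 < L" "\<exists>e. cube_at L e \<subseteq> \<Delta>"
    "\<And>L'. 0 < L' \<Longrightarrow> \<exists>e. cube_at L' e \<subseteq> \<Delta> \<Longrightarrow> L' \<le> L"
    using norm_length_attained[OF \<Delta>] by metis
  have len: "norm_length \<Delta>' = c * L"
    unfolding norm_length_def
  proof (rule Greatest_equality)
    show "0 < c * L \<and> (\<exists>e. cube_at (c * L) e \<subseteq> \<Delta>')"
      using L(2,3) c cube[OF L(2)] by (metis mult_pos_pos)
    fix L' assume L': "0 < L' \<and> (\<exists>e. cube_at L' e \<subseteq> \<Delta>')"
    then obtain e where "cube_at L' (h e) \<subseteq> \<Delta>'" using surj by metis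
    then have "cube_at (L' / c) e \<subseteq> \<Delta>" using cube[of "L' / c" e] L' c by simp
    then have "L' / c \<le> L" using L(4)[of "L' / c"] L' c by auto
    then show "L' \<le> c * L" using c by (simp add: field_simps)
  qed
  \<comment> \<open>A positive factor and a translation preserve equality and strict inequality in
    each coordinate.\<close>
  have lex: "lex_le (h x) (h y) \<longleftrightarrow> lex_le x y" for x y
    unfolding lex_le_def using c inj by (simp add: inj_eq) (simp add: h)
  let ?P = "\<lambda>\<Delta> a. cube_at (norm_length \<Delta>) a \<subseteq> \<Delta> \<and>
     (\<forall>e. cube_at (norm_length \<Delta>) e \<subseteq> \<Delta> \<longrightarrow> lex_le a e)"
  have "?P \<Delta> (norm_corner \<Delta>)"
    unfolding norm_corner_def by (rule theI'[OF norm_corner_unique[OF \<Delta>]])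
  then have "?P \<Delta>' (h (norm_corner \<Delta>))"
  proof -
    assume P: "?P \<Delta> (norm_corner \<Delta>)"
    show ?thesis
    proof (intro conjI allI impI)
      show "cube_at (norm_length \<Delta>') (h (norm_corner \<Delta>)) \<subseteq> \<Delta>'"
        using P cube[OF L(2)] by (simp add: len L(1))
      fix e assume e: "cube_at (norm_length \<Delta>') e \<subseteq> \<Delta>'"
      obtain e' where e': "e = h e'" using surj by blast
      have "cube_at (norm_length \<Delta>) e' \<subseteq> \<Delta>"
        using e cube[OF L(2)] by (simp add: len L(1) e')
      then show "lex_le (h (norm_corner \<Delta>)) e" using P by (simp add: e' lex)
    qed
  qed
  then have "norm_corner \<Delta>' = h (norm_corner \<Delta>)"
    unfolding norm_corner_def[of \<Delta>']
    using norm_corner_unique[OF \<Delta>' int'] by (intro the1_equality)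
  then show ?thesis
    by (auto simp: fun_eq_iff norm_map_def len L(1) h algebra_simps)
qed

section \<open>Similitudes\<close>

text \<open>Surjectivity is included because scaling distances does not imply it in a general metric
  space; with it, the map is a homeomorphism.\<close>

definition similitude :: "real \<Rightarrow> ('a::metric_space \<Rightarrow> 'a) \<Rightarrow> bool" where
  "similitude c f \<longleftrightarrow> 0 < c \<and> surj f \<and> (\<forall>x y. dist (f x) (f y) = c * dist x y)"

lemma similitude_id: "similitude 1 id"
  by (simp add: similitude_def)

lemma similitude_comp:
  assumes "similitude c f" "similitude c' g"
  shows "similitude (c * c') (f \<circ> g)"
  using assms comp_surj[of g f] by (simp add: similitude_def)

lemma similitude_bij:
  assumes "similitude c f"
  shows "bij f"
proof -
  have "inj f"
  proof (rule injI)
    fix x y assume "f x = f y"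
    then have "c * dist x y = 0" using assms unfolding similitude_def by (metis dist_self)
    then show "x = y" using assms by (simp add: similitude_def)
  qed
  then show ?thesis using assms by (simp add: bij_def similitude_def)
qed

lemma similitude_homeomorphism:
  assumes f: "similitude c f"
  shows "homeomorphism UNIV UNIV f (inv f)"
proof -
  have c: "0 < c" and d: "dist (f x) (f y) = c * dist x y" for x y
    using f by (auto simp: similitude_def)
  have b: "bij f" using similitude_bij[OF f] .
  have "dist (inv f x) (inv f y) = (1 / c) * dist x y" for x y
    using d[of "inv f x" "inv f y"] c b by (simp add: bij_is_surj surj_f_inv_f)
  then have "(1/c)-lipschitz_on UNIV (inv f)" using c by (intro lipschitz_onI) auto
  moreover have "c-lipschitz_on UNIV f" using c d by (intro lipschitz_onI) auto
  ultimately show ?thesis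
    using b lipschitz_on_continuous_on
    by (intro homeomorphismI) (auto simp: bij_is_surj surj_f_inv_f bij_is_inj)
qed

lemma similitude_open_image: "similitude c f \<Longrightarrow> open U \<Longrightarrow> open (f ` U)"
  using homeomorphism_imp_open_map[OF similitude_homeomorphism, of c f U] by simp

lemma similitude_closed_image: "similitude c f \<Longrightarrow> closed U \<Longrightarrow> closed (f ` U)"
  using homeomorphism_imp_closed_map[OF similitude_homeomorphism, of c f U] by simp

lemma similitude_interior_image:
  assumes f: "similitude c f"
  shows "interior (f ` A) = f ` interior A"
proof
  have b: "bij f" using similitude_bij[OF f] .
  show "f ` interior A \<subseteq> interior (f ` A)"
    using similitude_open_image[OF f] by (intro interior_maximal image_mono interior_subset) auto
  have "continuous_on UNIV f" using similitude_homeomorphism[OF f] homeomorphism_cont1 by blast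
  then have "open (f -` interior (f ` A))" by (intro open_vimage) auto
  moreover have "f -` interior (f ` A) \<subseteq> A"
    using interior_subset[of "f ` A"] inj_image_mem_iff[OF bij_is_inj[OF b]] by blast
  ultimately have "f -` interior (f ` A) \<subseteq> interior A" by (rule interior_maximal[rotated])
  then show "interior (f ` A) \<subseteq> f ` interior A"
    using bij_is_surj[OF b] by (metis image_mono surj_image_vimage_eq)
qed

text \<open>This will show that finitely many images of the boundary of the cube cannot fill an open
  set.\<close>

lemma interior_finite_UN_closed_empty:
  assumes "finite I" "\<And>i. i \<in> I \<Longrightarrow> closed (B i)" "\<And>i. i \<in> I \<Longrightarrow> interior (B i) = {}"
  shows "interior (\<Union>i\<in>I. B i) = {}"
  using assms
proof (induction I rule: finite_induct)
  case (insert i I)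
  then have "interior (B i \<union> (\<Union>i\<in>I. B i)) = interior (B i)"
    by (intro interior_closed_Un_empty_interior) auto
  then show ?case using insert by simp
qed simp

section \<open>Net intervals of a cube-filling system\<close>

lemma interior_Qcube: "interior Qcube = Vcube"
  by (simp add: Qcube_def Vcube_def)

lemma compact_Qcube: "compact Qcube"
  by (simp add: Qcube_def)

lemma open_Vcube: "open Vcube"
  by (simp add: Vcube_def open_box)

lemma frontier_Qcube: "frontier Qcube = Qcube - Vcube"
  by (simp add: Qcube_def Vcube_def frontier_cbox)

lemma Vcube_subset_Qcube: "Vcube \<subseteq> Qcube"
  using interior_Qcube interior_subset by metis

lemma zero_in_Vcube: "0 \<in> Vcube"
  by (simp add: Vcube_def mem_box_cart)

lemma interior_frontier_Qcube: "interior (frontier Qcube) = {}"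
proof -
  have "interior (frontier Qcube) \<subseteq> Vcube"
    using interior_mono[of "frontier Qcube" Qcube] by (auto simp: frontier_Qcube interior_Qcube)
  then show ?thesis using interior_subset[of "frontier Qcube"] by (auto simp: frontier_Qcube)
qed

text \<open>The orthogonal parts are absorbed into \<open>similitude\<close>, and
  \<open>Qcube_eq\<close> is the attractor equation after \<open>K\<close> has been replaced by the
  cube.\<close>

locale cube_ifs =
  fixes m :: nat and r :: real
    and S :: "nat \<Rightarrow> real ^ 'n::{finite,linorder} \<Rightarrow> real ^ 'n::{finite,linorder}"
  assumes r: "0 < r" "r < 1"
    and similitude_S: "\<And>i. i \<le> m \<Longrightarrow> similitude r (S i)"
    and Qcube_eq: "Qcube = (\<Union>i\<le>m. S i ` Qcube)"
begin

text \<open>Words that induce the same map are merged, just as they are in neighbor sets; this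
  matters when neighbors are counted.\<close>

definition maps :: "nat \<Rightarrow> ((real, 'n) vec \<Rightarrow> (real, 'n) vec) set" where
  "maps n = word_map S ` words m n"

text \<open>These are the base points at which net intervals of level \<open>n\<close> are
  formed.\<close>

definition generic :: "nat \<Rightarrow> (real, 'n) vec \<Rightarrow> bool" where
  "generic n x \<longleftrightarrow> x \<in> Qcube \<and> (\<forall>f\<in>maps n. x \<notin> f ` frontier Qcube)"

definition cover :: "nat \<Rightarrow> (real, 'n) vec \<Rightarrow> ((real, 'n) vec \<Rightarrow> (real, 'n) vec) set" where
  "cover n x = {f \<in> maps n. x \<in> f ` Vcube}"

abbreviation cell :: "nat \<Rightarrow> (real, 'n) vec \<Rightarrow> (real, 'n) vec set" where
  "cell \<equiv> net_cell m S"

text \<open>Compared with the cell, open and closed cubes are exchanged. The result is an open set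
  of points that share the cover of \<open>x\<close>.\<close>

definition core :: "nat \<Rightarrow> (real, 'n) vec \<Rightarrow> (real, 'n) vec set" where
  "core n x = (\<Inter>f\<in>cover n x. f ` Vcube) - (\<Union>f\<in>maps n - cover n x. f ` Qcube)"

section \<open>Images of the cube under words of a fixed length\<close>

lemma maps_0: "maps 0 = {id}"
proof -
  have "words m 0 = {[]}" by (auto simp: words_def)
  then show ?thesis by (simp add: maps_def)
qed

lemma word_map_append: "word_map S (\<sigma> @ \<tau>) = word_map S \<sigma> \<circ> word_map S \<tau>"
  by (induction \<sigma>) (auto simp: fun_eq_iff)

lemma comp_in_maps: "f \<in> maps a \<Longrightarrow> g \<in> maps b \<Longrightarrow> f \<circ> g \<in> maps (a + b)"
  unfolding maps_def by (force simp: word_map_append[symmetric] words_def)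

lemma maps_add_cases:
  assumes "h \<in> maps (a + b)"
  obtains f g where "f \<in> maps a" "g \<in> maps b" "h = f \<circ> g"
proof -
  obtain \<sigma> where \<sigma>: "\<sigma> \<in> words m (a + b)" "h = word_map S \<sigma>" using assms by (auto simp: maps_def)
  have "take a \<sigma> \<in> words m a" "drop a \<sigma> \<in> words m b"
    using \<sigma>(1) set_take_subset[of a \<sigma>] set_drop_subset[of a \<sigma>] by (auto simp: words_def)
  moreover have "h = word_map S (take a \<sigma>) \<circ> word_map S (drop a \<sigma>)"
    using \<sigma>(2) by (simp add: word_map_append[symmetric])
  ultimately show ?thesis using that unfolding maps_def by blast
qed

lemma S_in_maps: "i \<le> m \<Longrightarrow> S i \<in> maps 1"
  unfolding maps_def by (rule image_eqI[of _ _ "[i]"]) (auto simp: words_def)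

lemma finite_maps: "finite (maps n)"
proof -
  have "words m n = {\<sigma>. set \<sigma> \<subseteq> {..m} \<and> length \<sigma> = n}" by (auto simp: words_def)
  then show ?thesis by (simp add: maps_def finite_lists_length_eq)
qed

lemma similitude_maps:
  assumes "f \<in> maps n"
  shows "similitude (r ^ n) f"
proof -
  obtain \<sigma> where \<sigma>: "length \<sigma> = n" "set \<sigma> \<subseteq> {..m}" "f = word_map S \<sigma>"
    using assms by (auto simp: maps_def words_def)
  have "similitude (r ^ length \<sigma>) (word_map S \<sigma>)"
    using \<sigma>(2) by (induction \<sigma>) (auto simp: similitude_id intro: similitude_comp similitude_S)
  then show ?thesis using \<sigma> by simp
qed

lemma inj_maps: "f \<in> maps n \<Longrightarrow> inj f"
  using similitude_bij[OF similitude_maps] bij_is_inj by blast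

lemma open_image_maps: "f \<in> maps n \<Longrightarrow> open U \<Longrightarrow> open (f ` U)"
  using similitude_open_image[OF similitude_maps] .

lemma closed_image_maps: "f \<in> maps n \<Longrightarrow> closed U \<Longrightarrow> closed (f ` U)"
  using similitude_closed_image[OF similitude_maps] .

lemma maps_closed_frontier_image: "f \<in> maps n \<Longrightarrow> closed (f ` frontier Qcube)"
  by (rule closed_image_maps) auto

lemma maps_closed_cube: "f \<in> maps n \<Longrightarrow> closed (f ` Qcube)"
  by (rule closed_image_maps) (auto intro: compact_imp_closed compact_Qcube)

lemma maps_open_cube: "f \<in> maps n \<Longrightarrow> open (f ` Vcube)"
  by (rule open_image_maps) (auto intro: open_Vcube)

lemma maps_interior_frontier: "f \<in> maps n \<Longrightarrow> interior (f ` frontier Qcube) = {}"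
  using similitude_interior_image[OF similitude_maps] interior_frontier_Qcube by fastforce

lemma Qcube_cover: "Qcube = (\<Union>f\<in>maps n. f ` Qcube)"
proof (induction n)
  case 0
  then show ?case by (simp add: maps_0)
next
  case (Suc n)
  show ?case
  proof
    show "Qcube \<subseteq> (\<Union>f\<in>maps (Suc n). f ` Qcube)"
    proof
      fix x assume "x \<in> (Qcube :: (real, 'n) vec set)"
      then obtain f y where f: "f \<in> maps n" "y \<in> Qcube" "x = f y" using Suc by blast
      then obtain i z where i: "i \<le> m" "z \<in> Qcube" "y = S i z" using Qcube_eq by blast
      have "f \<circ> S i \<in> maps (Suc n)" using comp_in_maps[OF f(1) S_in_maps[OF i(1)]] by simp
      moreover have "x = (f \<circ> S i) z" using f i by simp
      ultimately show "x \<in> (\<Union>f\<in>maps (Suc n). f ` Qcube)" using i(2) by blast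
    qed
    show "(\<Union>f\<in>maps (Suc n). f ` Qcube) \<subseteq> Qcube"
    proof
      fix x assume "x \<in> (\<Union>f\<in>maps (Suc n). f ` Qcube)"
      \<comment> \<open>Here the first letter is split off, whereas the other inclusion appends a
        last letter.\<close>
      then obtain h z where h: "h \<in> maps (1 + n)" "z \<in> Qcube" "x = h z" by auto
      from h(1) obtain f g where fg: "f \<in> maps 1" "g \<in> maps n" "h = f \<circ> g"
        by (rule maps_add_cases)
      obtain i where "i \<le> m" "f = S i"
        using fg(1) by (auto simp: maps_def words_def length_Suc_conv)
      moreover have "g z \<in> Qcube" using Suc fg(2) h(2) by blast
      ultimately show "x \<in> Qcube" using h(3) fg(3) Qcube_eq by auto
    qed
  qed
qed

lemma maps_Qcube_subset: "f \<in> maps n \<Longrightarrow> f ` Qcube \<subseteq> Qcube"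
  using Qcube_cover[of n] by blast

lemma maps_Vcube_subset:
  assumes "f \<in> maps n"
  shows "f ` Vcube \<subseteq> Vcube"
proof -
  have "f ` Vcube \<subseteq> interior Qcube"
    using maps_open_cube[OF assms] maps_Qcube_subset[OF assms] Vcube_subset_Qcube
    by (intro interior_maximal) auto
  then show ?thesis by (simp add: interior_Qcube)
qed

section \<open>Generic points and their cells\<close>

text \<open>Up to level \<open>N\<close> there are finitely many boundary images, all closed and
  without interior. Treating all these levels at once yields one base point for a whole chain of
  cells.\<close>

lemma ex_generic:
  assumes "open U" "U \<noteq> {}" "U \<subseteq> Qcube"
  shows "\<exists>y\<in>U. \<forall>k\<le>N. generic k y"
proof -
  let ?F = "\<Union>f\<in>(\<Union>k\<le>N. maps k). f ` frontier Qcube"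
  have "interior ?F = {}"
    by (rule interior_finite_UN_closed_empty)
      (auto simp: finite_maps maps_interior_frontier dest: maps_closed_frontier_image)
  then have "\<not> U \<subseteq> ?F" using assms interior_maximal[of U ?F] by auto
  then obtain y where "y \<in> U" "y \<notin> ?F" by blast
  then show ?thesis using assms(3) by (intro bexI[of _ y]) (auto simp: generic_def)
qed

lemma generic_in_Vcube:
  "generic n x \<Longrightarrow> f \<in> maps n \<Longrightarrow> x \<in> f ` Qcube \<Longrightarrow> x \<in> f ` Vcube"
  by (auto simp: generic_def frontier_Qcube)

lemma finite_cover: "finite (cover n x)"
  using finite_maps by (simp add: cover_def)

lemma cover_nonempty:
  assumes "generic n x"
  shows "cover n x \<noteq> {}"
proof -
  have "x \<in> Qcube" using assms by (simp add: generic_def)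
  then obtain f where "f \<in> maps n" "x \<in> f ` Qcube" using Qcube_cover[of n] by blast
  then show ?thesis using generic_in_Vcube[OF assms] by (auto simp: cover_def)
qed

lemma cell_eq: "cell n x = (\<Inter>f\<in>cover n x. f ` Qcube) - (\<Union>f\<in>maps n - cover n x. f ` Vcube)"
proof -
  have 1: "cover n x = word_map S ` {\<sigma> \<in> words m n. x \<in> word_map S \<sigma> ` Vcube}"
    by (auto simp: cover_def maps_def)
  have 2: "maps n - cover n x = word_map S ` {\<sigma> \<in> words m n. x \<notin> word_map S \<sigma> ` Vcube}"
    by (auto simp: cover_def maps_def)
  show ?thesis unfolding net_cell_def 2 unfolding 1 by simp
qed

lemma open_core: "open (core n x)"
  unfolding core_def using finite_maps finite_cover
  by (intro open_Diff open_INT closed_UN) (auto simp: cover_def intro: maps_open_cube maps_closed_cube)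

lemma generic_in_core: "generic n x \<Longrightarrow> x \<in> core n x"
  using generic_in_Vcube by (auto simp: core_def cover_def)

lemma core_subset_Qcube:
  assumes "generic n x"
  shows "core n x \<subseteq> Qcube"
proof -
  obtain f where f: "f \<in> cover n x" using cover_nonempty[OF assms] by blast
  then have "core n x \<subseteq> f ` Vcube" by (auto simp: core_def)
  also have "\<dots> \<subseteq> Vcube" using f maps_Vcube_subset unfolding cover_def by blast
  finally show ?thesis using Vcube_subset_Qcube by blast
qed

lemma cover_core: "y \<in> core n x \<Longrightarrow> cover n y = cover n x"
  using Vcube_subset_Qcube unfolding core_def cover_def by blast

text \<open>The base point of a cell can thus be moved to one that is generic for further
  levels.\<close>

lemma cell_core: "y \<in> core n x \<Longrightarrow> cell n y = cell n x"
  by (simp add: cell_eq cover_core)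

lemma core_subset_interior_cell: "core n x \<subseteq> interior (cell n x)"
proof (rule interior_maximal[OF _ open_core])
  show "core n x \<subseteq> cell n x"
    unfolding core_def cell_eq
    by (intro Diff_mono INF_mono' SUP_mono' image_mono Vcube_subset_Qcube)
qed

lemma compact_cell:
  assumes "generic n x"
  shows "compact (cell n x)"
proof -
  have "closed (cell n x)"
    unfolding cell_eq using finite_maps
    by (intro closed_Diff closed_INT open_UN) (auto simp: cover_def intro: maps_open_cube maps_closed_cube)
  moreover have "cell n x \<subseteq> Qcube"
  proof -
    obtain f where f: "f \<in> cover n x" using cover_nonempty[OF assms] by blast
    then have "cell n x \<subseteq> f ` Qcube" by (auto simp: cell_eq)
    also have "\<dots> \<subseteq> Qcube" using f maps_Qcube_subset unfolding cover_def by blast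
    finally show ?thesis .
  qed
  ultimately show ?thesis
    using compact_Qcube by (metis compact_Int_closed inf.absorb_iff2)
qed

lemma interior_cell_nonempty: "generic n x \<Longrightarrow> interior (cell n x) \<noteq> {}"
  using generic_in_core core_subset_interior_cell by blast

text \<open>A generic point lies both in the cube and in the interior of its own cell, so that
  interior meets the attractor.\<close>

lemma net_intervals_eq: "net_intervals m S Qcube n = {cell n x | x. generic n x}"
proof -
  have *: "x \<in> Qcube - (\<Union>\<sigma> \<in> words m n. word_map S \<sigma> ` frontier Qcube) \<longleftrightarrow> generic n x" for x
    by (auto simp: generic_def maps_def)
  have "interior (cell n x) \<inter> Qcube \<noteq> {}" if "generic n x" for x
    using generic_in_core[OF that] core_subset_interior_cell[of n x] core_subset_Qcube[OF that]
    by blast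
  then show ?thesis unfolding net_intervals_def * by blast
qed

section \<open>Neighbors as covering maps, and children\<close>

text \<open>A closed cube containing the cell contains \<open>x\<close>, and for a generic point
  this means lying in the open cube.\<close>

lemma maps_containing_cell:
  assumes "generic n x"
  shows "{f \<in> maps n. cell n x \<subseteq> f ` Qcube} = cover n x"
proof
  have "x \<in> cell n x"
    using generic_in_core[OF assms] core_subset_interior_cell interior_subset by blast
  then show "{f \<in> maps n. cell n x \<subseteq> f ` Qcube} \<subseteq> cover n x"
    using generic_in_Vcube[OF assms] by (auto simp: cover_def)
qed (auto simp: cell_eq cover_def)

lemma neighbor_set_eq:
  assumes "generic n x"
  shows "neighbor_set m S n (cell n x) = (\<lambda>f. inv (norm_map (cell n x)) \<circ> f) ` cover n x"
  unfolding maps_containing_cell[OF assms, symmetric] neighbor_set_def maps_def by auto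

text \<open>Composition with the inverse normalization is injective. Hence the vertex determines the
  size of the cover, and finitely many vertices bound it.\<close>

lemma card_neighbor_set:
  assumes "generic n x"
  shows "card (neighbor_set m S n (cell n x)) = card (cover n x)"
proof -
  have "bij (norm_map (cell n x))"
    using bij_norm_map[OF compact_cell interior_cell_nonempty] assms by simp
  then have "inj (inv (norm_map (cell n x)))" by (simp add: bij_imp_bij_inv bij_is_inj)
  then have "inj (\<lambda>f :: (real, 'n) vec \<Rightarrow> (real, 'n) vec. inv (norm_map (cell n x)) \<circ> f)"
    by (auto simp: inj_def fun_eq_iff)
  then show ?thesis unfolding neighbor_set_eq[OF assms] by (rule card_image[OF inj_on_subset]) simp
qed

lemma graph_verts_eq:
  "graph_verts m S Qcube = {neighbor_set m S n (cell n x) | n x. generic n x}"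
  unfolding graph_verts_def net_intervals_eq by blast

text \<open>If \<open>f\<close> covers \<open>x\<close>, some refinement of \<open>f\<close> covers
  \<open>x\<close> at the next level and confines the child to the cube of \<open>f\<close>. If
  \<open>f\<close> does not cover \<open>x\<close>, neither does any refinement, so their open cubes
  are all removed from the child.\<close>

lemma is_child_cell:
  assumes "generic n x" "generic (Suc n) x"
  shows "is_child (cell (Suc n) x) (cell n x)"
  unfolding is_child_def
proof
  fix y assume y: "y \<in> interior (cell (Suc n) x)"
  have split: "f \<circ> g \<in> maps (Suc n)" if "f \<in> maps n" "g \<in> maps 1" for f g
    using comp_in_maps[OF that] by simp
  show "y \<in> cell n x"
    unfolding cell_eq
  proof (intro DiffI INT_I notI)
    fix f assume f: "f \<in> cover n x"
    then obtain z where z: "x = f z" "z \<in> Qcube" "f \<in> maps n"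
      using Vcube_subset_Qcube unfolding cover_def by blast
    then obtain g where g: "g \<in> maps 1" "z \<in> g ` Qcube" using Qcube_cover[of 1] by blast
    then have "f \<circ> g \<in> cover (Suc n) x"
      using generic_in_Vcube[OF assms(2) split[OF z(3) g(1)]] split[OF z(3) g(1)] z(1)
      by (auto simp: cover_def)
    then have "y \<in> (f \<circ> g) ` Qcube"
      using y interior_subset unfolding cell_eq by blast
    then show "y \<in> f ` Qcube" using maps_Qcube_subset[OF g(1)] by auto
  next
    assume "y \<in> (\<Union>f\<in>maps n - cover n x. f ` Vcube)"
    then obtain f where f: "f \<in> maps n" "x \<notin> f ` Vcube" "y \<in> f ` Vcube"
      unfolding cover_def by blast
    \<comment> \<open>The point \<open>y\<close> may lie on a boundary at level
      \<open>Suc n\<close>. Passing to the interior of the child leaves room for a generic point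
      \<open>w\<close> in its place.\<close>
    let ?U = "f ` Vcube \<inter> interior (cell (Suc n) x)"
    have "open ?U" using maps_open_cube[OF f(1)] by auto
    moreover have "?U \<noteq> {}" using y f by blast
    moreover have "?U \<subseteq> Qcube" using maps_Vcube_subset[OF f(1)] Vcube_subset_Qcube by blast
    ultimately obtain w where w: "w \<in> ?U" "generic (Suc n) w"
      using ex_generic[of ?U "Suc n"] by blast
    then obtain z where z: "w = f z" "z \<in> Qcube" using Vcube_subset_Qcube by blast
    then obtain g where g: "g \<in> maps 1" "z \<in> g ` Qcube" using Qcube_cover[of 1] by blast
    have fg: "f \<circ> g \<in> maps (Suc n)" using split f g by blast
    then have "w \<in> (f \<circ> g) ` Vcube" using generic_in_Vcube[OF w(2) fg] g z by auto
    moreover have "x \<notin> (f \<circ> g) ` Vcube"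
      using f(2) maps_Vcube_subset[OF g(1)] by auto
    ultimately show False
      using w(1) interior_subset[of "cell (Suc n) x"] fg unfolding cell_eq cover_def by blast
  qed
qed

lemma graph_edges_subset: "graph_edges m S Qcube \<subseteq> graph_verts m S Qcube \<times> graph_verts m S Qcube"
  unfolding graph_edges_def graph_verts_def by blast

text \<open>The cells around one fixed point form a chain of children.\<close>

lemma descendant_path:
  assumes "n \<le> N" "\<forall>k\<le>N. generic k y"
  shows "(neighbor_set m S n (cell n y), neighbor_set m S N (cell N y)) \<in> (graph_edges m S Qcube)\<^sup>*"
  using assms
proof (induction N rule: dec_induct)
  case (step N)
  have g: "generic N y" "generic (Suc N) y" using step.prems by auto
  then have "(neighbor_set m S N (cell N y), neighbor_set m S (Suc N) (cell (Suc N) y)) \<in> graph_edges m S Qcube"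
    unfolding graph_edges_def net_intervals_eq using is_child_cell[OF g] by blast
  moreover have "(neighbor_set m S n (cell n y), neighbor_set m S N (cell N y)) \<in> (graph_edges m S Qcube)\<^sup>*"
    using step by simp
  ultimately show ?case by (rule rtrancl_into_rtrancl[rotated])
qed simp

section \<open>Powers without rotation\<close>

lemma funpow_in_maps: "f \<in> maps t \<Longrightarrow> f ^^ k \<in> maps (k * t)"
proof (induction k)
  case (Suc k)
  then show ?case using comp_in_maps[of f t "f ^^ k" "k * t"] by (simp add: comp_def)
qed (simp add: maps_0 id_def)

text \<open>
  The powers of \<open>f\<close>, suitably normalized, all occur in neighbor sets.  By finiteness two of them
  agree, so that \<open>f ^^ b = H \<circ> f ^^ a\<close> with a homothety \<open>H\<close> and \<open>a < b\<close>.
\<close>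

lemma ex_funpow_homothety:
  assumes fin: "finite (graph_verts m S Qcube)" and f: "f \<in> maps t"
  shows "\<exists>k c b. 0 < k \<and> 0 < c \<and> (\<forall>x. (f ^^ k) x = c *\<^sub>R x + b)"
proof -
  \<comment> \<open>Any generic point in the image of \<open>Vcube\<close> under
    \<open>f ^^ k\<close> makes this power a neighbor of some cell.\<close>
  have "\<exists>x. generic (k * t) x \<and> f ^^ k \<in> cover (k * t) x" for k
  proof -
    have fk: "f ^^ k \<in> maps (k * t)" using funpow_in_maps[OF f] .
    have "(f ^^ k) ` Vcube \<subseteq> Qcube" using maps_Vcube_subset[OF fk] Vcube_subset_Qcube by blast
    moreover have "(f ^^ k) ` Vcube \<noteq> {}" using zero_in_Vcube by blast
    ultimately obtain x where "x \<in> (f ^^ k) ` Vcube" "generic (k * t) x"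
      using ex_generic[OF maps_open_cube[OF fk]] by blast
    then show ?thesis using fk by (auto simp: cover_def)
  qed
  then obtain x where x: "\<And>k. generic (k * t) (x k)" "\<And>k. f ^^ k \<in> cover (k * t) (x k)"
    by metis
  define T where "T k = norm_map (cell (k * t) (x k))" for k
  define N where "N k = inv (T k) \<circ> f ^^ k" for k
  \<comment> \<open>There are finitely many neighbor sets, each of them finite, so two of the
    normalized powers \<open>N k\<close> must coincide.\<close>
  have "finite (\<Union> (graph_verts m S Qcube))"
  proof (rule finite_Union[OF fin])
    fix M assume "M \<in> graph_verts m S Qcube"
    then obtain n z where "generic n z" "M = neighbor_set m S n (cell n z)"
      unfolding graph_verts_eq by blast
    then show "finite M" by (simp add: neighbor_set_eq finite_cover)
  qed
  moreover have "range N \<subseteq> \<Union> (graph_verts m S Qcube)"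
  proof
    fix g assume "g \<in> range N"
    then obtain k where "g = N k" by blast
    then have "g \<in> neighbor_set m S (k * t) (cell (k * t) (x k))"
      unfolding neighbor_set_eq[OF x(1)] N_def T_def using x(2) by blast
    then show "g \<in> \<Union> (graph_verts m S Qcube)" unfolding graph_verts_eq using x(1) by blast
  qed
  ultimately have "finite (range N)" by (rule finite_subset[rotated])
  then have "\<not> inj N" using finite_imageD infinite_UNIV_nat by blast
  then obtain a b where ab: "a < b" "N a = N b"
    unfolding inj_def by (metis linorder_neqE_nat)
  have T: "T k (N k y) = (f ^^ k) y" for k y
  proof -
    have "bij (T k)" unfolding T_def
      by (rule bij_norm_map[OF compact_cell[OF x(1)] interior_cell_nonempty[OF x(1)]])
    then show ?thesis by (simp add: N_def bij_is_surj surj_f_inv_f)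
  qed
  define L where "L k = norm_length (cell (k * t) (x k))" for k
  define e where "e k = norm_corner (cell (k * t) (x k))" for k
  have L: "0 < L k" for k
    unfolding L_def by (rule norm_length_pos[OF compact_cell[OF x(1)] interior_cell_nonempty[OF x(1)]])
  have TL: "T k y = L k *\<^sub>R y + e k" for k y by (simp add: T_def norm_map_def L_def e_def)
  \<comment> \<open>The maps \<open>T a\<close> and \<open>T b\<close> involve no rotation, hence
    neither does \<open>T b\<close> composed with the inverse of \<open>T a\<close>. Since
    \<open>f ^^ a\<close> is onto, it can be cancelled, which identifies this homothety with
    \<open>f ^^ (b - a)\<close>.\<close>
  have "(f ^^ (b - a)) y = (L b / L a) *\<^sub>R y + (e b - (L b / L a) *\<^sub>R e a)" for y
  proof -
    have "surj (f ^^ a)"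
      using similitude_bij[OF similitude_maps[OF funpow_in_maps[OF f]]] bij_is_surj by blast
    then obtain z where z: "y = (f ^^ a) z" by (metis surjD)
    have y: "y = L a *\<^sub>R N a z + e a" using T[of a z] TL z by metis
    have "(f ^^ (b - a)) y = (f ^^ b) z"
      using ab(1) z by (metis comp_apply funpow_add le_add_diff_inverse2 less_imp_le)
    also have "\<dots> = L b *\<^sub>R N a z + e b" using T[of b z] TL ab(2) by metis
    also have "N a z = (1 / L a) *\<^sub>R (y - e a)" unfolding y using L[of a] by simp
    finally show ?thesis by (simp add: algebra_simps)
  qed
  moreover have "0 < b - a" "0 < L b / L a" using ab L by auto
  ultimately show ?thesis by blast
qed

section \<open>Copying a vertex with the maximal number of neighbors\<close>

text \<open>Cubes of level \<open>t\<close> shrink like \<open>r ^ t\<close>, so one through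
  \<open>x\<close> of high level fits into \<open>U\<close>. The bound \<open>n\<close> on the level
  ensures that cells formed inside it can be descendants of a cell of level
  \<open>n\<close>.\<close>

lemma ex_small_cube:
  assumes "open U" "x \<in> U" "x \<in> Qcube"
  shows "\<exists>t\<ge>n. \<exists>f\<in>maps t. f ` Qcube \<subseteq> U"
proof -
  obtain e where e: "0 < e" "ball x e \<subseteq> U" using assms open_contains_ball by blast
  \<comment> \<open>Adding one makes \<open>D\<close> positive without computing the
    diameter.\<close>
  define D where "D = diameter (Qcube :: (real, 'n) vec set) + 1"
  have bdd: "bounded (Qcube :: (real, 'n) vec set)" using compact_Qcube compact_imp_bounded by blast
  then have D: "0 < D" using diameter_ge_0[OF bdd] by (simp add: D_def)
  have dist_D: "dist u v \<le> D" if "u \<in> Qcube" "v \<in> Qcube" for u v :: "(real, 'n) vec"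
    using diameter_bounded_bound[OF bdd that] by (simp add: D_def)
  obtain M where M: "r ^ M < e / D" using real_arch_pow_inv[of "e / D" r] e D r by auto
  define t where "t = max n M"
  have "r ^ t \<le> r ^ M" using r by (intro power_decreasing) (auto simp: t_def)
  then have "r ^ t < e / D" using M by simp
  then have t: "r ^ t * D < e" using D by (simp add: field_simps)
  obtain f where f: "f \<in> maps t" "x \<in> f ` Qcube" using assms(3) Qcube_cover[of t] by blast
  have "f ` Qcube \<subseteq> ball x e"
  proof
    fix y assume "y \<in> f ` Qcube"
    then obtain u v where uv: "u \<in> Qcube" "v \<in> Qcube" "x = f u" "y = f v" using f(2) by blast
    have "dist x y = r ^ t * dist u v"
      using similitude_maps[OF f(1)] uv by (simp add: similitude_def)
    also have "\<dots> \<le> r ^ t * D" using dist_D uv r by (intro mult_left_mono) auto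
    finally show "y \<in> ball x e" using t by simp
  qed
  then show ?thesis using f(1) e(2) by (intro exI[of _ t]) (auto simp: t_def)
qed

text \<open>Passing to a power in order to remove the rotation keeps the image inside the chosen
  small cube.\<close>

lemma funpow_image_subset:
  assumes "f \<in> maps t" "0 < k"
  shows "(f ^^ k) ` Qcube \<subseteq> f ` Qcube"
proof -
  obtain j where "k = Suc j" using assms(2) gr0_implies_Suc by blast
  then have "(f ^^ k) ` Qcube = f ` (f ^^ j) ` Qcube" by (simp add: image_comp)
  then show ?thesis using maps_Qcube_subset[OF funpow_in_maps[OF assms(1)]] by blast
qed

text \<open>
  Inside \<open>h ` cell l x\<^sub>0\<close>, every generic point of level \<open>T + l\<close> is covered by all the maps
  \<open>h \<circ> g\<close>, where \<open>g\<close> covers \<open>x\<^sub>0\<close>.  Maximality of the number of neighbors of \<open>x\<^sub>0\<close> leaves no room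
  for any other map, so the cell is reproduced up to sets without interior.
\<close>

lemma neighbor_set_copy:
  assumes x0: "generic l x\<^sub>0" and max: "\<And>n x. generic n x \<Longrightarrow> card (cover n x) \<le> card (cover l x\<^sub>0)"
    and h: "h \<in> maps T" "0 < c" "\<And>x. h x = c *\<^sub>R x + b"
    and y: "generic (T + l) y" "y \<in> h ` core l x\<^sub>0"
  shows "neighbor_set m S (T + l) (cell (T + l) y) = neighbor_set m S l (cell l x\<^sub>0)"
proof -
  let ?N = "T + l"
  have inj: "inj h" using inj_maps[OF h(1)] .
  have injc: "inj (\<lambda>g :: (real, 'n) vec \<Rightarrow> (real, 'n) vec. h \<circ> g)"
    using inj by (auto simp: inj_def fun_eq_iff)
  have hmaps: "h \<circ> g \<in> maps ?N" if "g \<in> maps l" for g using comp_in_maps[OF h(1) that] .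
  let ?C = "(\<lambda>g. h \<circ> g) ` cover l x\<^sub>0"
  have cardC: "card ?C = card (cover l x\<^sub>0)" by (rule card_image[OF inj_on_subset[OF injc]]) simp
  obtain z where z: "y = h z" "z \<in> core l x\<^sub>0" using y(2) by blast
  have "?C \<subseteq> cover ?N y"
  proof
    fix f assume "f \<in> ?C"
    then obtain g where g: "g \<in> cover l z" "f = h \<circ> g" using cover_core[OF z(2)] by auto
    then show "f \<in> cover ?N y" using hmaps z(1) by (auto simp: cover_def)
  qed
  \<comment> \<open>The copied maps already reach the maximal number of neighbors, so they exhaust
    the cover of \<open>y\<close>.\<close>
  then have cov: "cover ?N y = ?C"
    using card_seteq[OF finite_cover] max[OF y(1)] cardC by metis
  \<comment> \<open>This inclusion holds for entire cells, as each open cube removed around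
    \<open>x\<^sub>0\<close> is removed around \<open>y\<close> after applying \<open>h\<close>. The
    reverse inclusion is shown for the interior only, because further cubes of level
    \<open>?N\<close> may cut off remnants.\<close>
  have "cell ?N y \<subseteq> h ` cell l x\<^sub>0"
  proof
    fix w assume w: "w \<in> cell ?N y"
    have wQ: "w \<in> h ` g ` Qcube" if "g \<in> cover l x\<^sub>0" for g
      using w that unfolding cell_eq cov by (auto simp: image_comp)
    obtain u where u: "w = h u" using wQ cover_nonempty[OF x0] by blast
    have "u \<in> g ` Qcube" if "g \<in> cover l x\<^sub>0" for g
      using wQ[OF that] inj unfolding u by (simp add: inj_image_mem_iff)
    moreover have "u \<notin> g ` Vcube" if "g \<in> maps l - cover l x\<^sub>0" for g
    proof
      assume "u \<in> g ` Vcube"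
      then have "w \<in> (h \<circ> g) ` Vcube" using u by auto
      moreover have "h \<circ> g \<in> maps ?N - cover ?N y"
        using that hmaps injc unfolding cov by (auto simp: inj_image_mem_iff dest: injD[OF injc])
      ultimately show False using w unfolding cell_eq by blast
    qed
    ultimately have "u \<in> cell l x\<^sub>0" unfolding cell_eq by blast
    then show "w \<in> h ` cell l x\<^sub>0" using u by blast
  qed
  then have sub1: "interior (cell ?N y) \<subseteq> h ` interior (cell l x\<^sub>0)"
    using interior_mono similitude_interior_image[OF similitude_maps[OF h(1)]] by metis
  have inC: "u \<in> (h \<circ> g) ` Qcube" if u: "u \<in> h ` interior (cell l x\<^sub>0)" and g: "g \<in> cover l x\<^sub>0" for u g
  proof -
    obtain v where "u = h v" "v \<in> cell l x\<^sub>0" using u interior_subset[of "cell l x\<^sub>0"] by blast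
    then show ?thesis using g unfolding cell_eq by auto
  qed
  have op: "open (h ` interior (cell l x\<^sub>0))" using open_image_maps[OF h(1)] by simp
  have "h ` interior (cell l x\<^sub>0) \<subseteq> cell ?N y"
  proof
    fix w assume w: "w \<in> h ` interior (cell l x\<^sub>0)"
    \<comment> \<open>Otherwise \<open>f\<close> and all the copied maps would cover a common
      generic point, which would have one neighbor too many.\<close>
    have "w \<notin> f ` Vcube" if f: "f \<in> maps ?N - cover ?N y" for f
    proof
      assume wf: "w \<in> f ` Vcube"
      let ?U = "f ` Vcube \<inter> h ` interior (cell l x\<^sub>0)"
      have fm: "f \<in> maps ?N" using f by blast
      have "open ?U" using maps_open_cube[OF fm] op by blast
      moreover have "?U \<noteq> {}" using w wf by blast
      moreover have "?U \<subseteq> Qcube" using maps_Vcube_subset[OF fm] Vcube_subset_Qcube by blast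
      ultimately obtain v where v: "v \<in> ?U" "generic ?N v" using ex_generic[of ?U ?N] by blast
      have "h \<circ> g \<in> cover ?N v" if "g \<in> cover l x\<^sub>0" for g
        using inC[of v g] v that generic_in_Vcube[OF v(2)] hmaps[of g] unfolding cover_def by blast
      then have "insert f ?C \<subseteq> cover ?N v" using v(1) fm by (auto simp: cover_def)
      then have "card (insert f ?C) \<le> card (cover ?N v)" by (rule card_mono[OF finite_cover])
      moreover have "f \<notin> ?C" "finite ?C" using f cov finite_cover by auto
      ultimately show False using max[OF v(2)] cardC by simp
    qed
    moreover have "w \<in> f ` Qcube" if "f \<in> cover ?N y" for f
      using that inC[OF w] unfolding cov by blast
    ultimately show "w \<in> cell ?N y" unfolding cell_eq by blast
  qed
  then have "h ` interior (cell l x\<^sub>0) \<subseteq> interior (cell ?N y)" using op by (rule interior_maximal)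
  with sub1 have int: "interior (cell ?N y) = h ` interior (cell l x\<^sub>0)" by (rule equalityI)
  have comp0: "compact (cell l x\<^sub>0)" "interior (cell l x\<^sub>0) \<noteq> {}"
    using compact_cell[OF x0] interior_cell_nonempty[OF x0] .
  have "norm_map (cell ?N y) = h \<circ> norm_map (cell l x\<^sub>0)"
    by (rule norm_map_homothety[OF comp0 compact_cell[OF y(1)] h(2,3) int])
  then have "inv (norm_map (cell ?N y)) = inv (norm_map (cell l x\<^sub>0)) \<circ> inv h"
    using o_inv_distrib[OF similitude_bij[OF similitude_maps[OF h(1)]] bij_norm_map[OF comp0]] by simp
  \<comment> \<open>The factor \<open>h\<close> cancels between the normalization and the neighbor,
    so the two normalized maps agree.\<close>
  then have eq: "inv (norm_map (cell ?N y)) \<circ> (h \<circ> g) = inv (norm_map (cell l x\<^sub>0)) \<circ> g" for g :: "(real, 'n) vec \<Rightarrow> (real, 'n) vec"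
    using inj by (simp add: fun_eq_iff)
  show ?thesis
    unfolding neighbor_set_eq[OF y(1)] neighbor_set_eq[OF x0] cov image_image eq ..
qed

lemma ex1_essential_class_net_intervals:
  assumes fin: "finite (graph_verts m S Qcube)"
  shows "\<exists>!C. essential_class (graph_verts m S Qcube) (graph_edges m S Qcube) C"
proof -
  have "\<exists>x\<in>Vcube. \<forall>k\<le>0. generic k x"
    using ex_generic[of Vcube 0] open_Vcube zero_in_Vcube Vcube_subset_Qcube by blast
  then obtain x1 where x1: "generic 0 x1" by blast
  \<comment> \<open>Level and base point are paired so that the maximum is taken over all levels at
    once.\<close>
  have "\<exists>b. \<forall>q. generic (fst q) (snd q) \<longrightarrow> card (cover (fst q) (snd q)) < b"
  proof (intro exI allI impI)
    fix q assume g: "generic (fst q) (snd q)"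
    then have "neighbor_set m S (fst q) (cell (fst q) (snd q)) \<in> graph_verts m S Qcube"
      unfolding graph_verts_eq by blast
    then show "card (cover (fst q) (snd q)) < Suc (Max (card ` graph_verts m S Qcube))"
      unfolding card_neighbor_set[OF g, symmetric] less_Suc_eq_le using fin by (intro Max_ge) auto
  qed
  then obtain B where "\<forall>q. generic (fst q) (snd q) \<longrightarrow> card (cover (fst q) (snd q)) < B" ..
  then have "\<exists>q. generic (fst q) (snd q) \<and>
      (\<forall>q'. generic (fst q') (snd q') \<longrightarrow> card (cover (fst q') (snd q')) \<le> card (cover (fst q) (snd q)))"
    using x1 by (intro ex_has_greatest_nat[of _ "(0, x1)"]) auto
  then obtain q where q: "generic (fst q) (snd q)"
    "\<And>q'. generic (fst q') (snd q') \<Longrightarrow> card (cover (fst q') (snd q')) \<le> card (cover (fst q) (snd q))"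
    by blast
  define l where "l = fst q"
  define x0 where "x0 = snd q"
  have x0: "generic l x0" using q(1) by (simp add: l_def x0_def)
  have max: "card (cover n x) \<le> card (cover l x0)" if "generic n x" for n x
    using q(2)[of "(n, x)"] that by (simp add: l_def x0_def)
  show ?thesis
  proof (rule ex1_essential_class)
    show "neighbor_set m S l (cell l x0) \<in> graph_verts m S Qcube"
      unfolding graph_verts_eq using x0 by blast
    show "graph_edges m S Qcube \<subseteq> graph_verts m S Qcube \<times> graph_verts m S Qcube"
      by (rule graph_edges_subset)
    fix w assume "w \<in> graph_verts m S Qcube"
    then obtain n x where w: "generic n x" "w = neighbor_set m S n (cell n x)"
      unfolding graph_verts_eq by blast
    obtain t f where f: "n \<le> t" "f \<in> maps t" "f ` Qcube \<subseteq> core n x"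
      using ex_small_cube[OF open_core generic_in_core[OF w(1)], of n] w(1) by (auto simp: generic_def)
    obtain k c b where k: "0 < k" "0 < c" "\<And>x. (f ^^ k) x = c *\<^sub>R x + b"
      using ex_funpow_homothety[OF fin f(2)] by blast
    define h where "h = f ^^ k"
    have h: "h \<in> maps (k * t)" unfolding h_def using funpow_in_maps[OF f(2)] .
    have hQ: "h ` Qcube \<subseteq> core n x" using funpow_image_subset[OF f(2) k(1)] f(3) h_def by blast
    let ?N = "k * t + l"
    have "n \<le> t" "t \<le> k * t" using f(1) k(1) by auto
    then have nN: "n \<le> ?N" by linarith
    have "open (h ` core l x0)" using open_image_maps[OF h open_core] .
    moreover have "h ` core l x0 \<noteq> {}" using generic_in_core[OF x0] by blast
    moreover have "h ` core l x0 \<subseteq> Qcube"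
      using core_subset_Qcube[OF x0] maps_Qcube_subset[OF h] by blast
    ultimately obtain y where y: "y \<in> h ` core l x0" "\<forall>k\<le>?N. generic k y"
      using ex_generic by meson
    \<comment> \<open>Thus \<open>y\<close> serves as a base point for \<open>w\<close> as well, and
      the chain of cells around \<open>y\<close> leads from \<open>w\<close> to the copy of the
      vertex of \<open>x0\<close>.\<close>
    have "y \<in> core n x" using y(1) hQ core_subset_Qcube[OF x0] by blast
    then have "w = neighbor_set m S n (cell n y)" using w(2) cell_core by simp
    moreover have "neighbor_set m S ?N (cell ?N y) = neighbor_set m S l (cell l x0)"
      using neighbor_set_copy[OF x0 max h k(2) k(3)[folded h_def] _ y(1)] y(2) by simp
    ultimately show "(w, neighbor_set m S l (cell l x0)) \<in> (graph_edges m S Qcube)\<^sup>*"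
      using descendant_path[OF nN y(2)] by simp
  qed
qed

end

section \<open>From affine maps with orthogonal parts to similitudes\<close>

theorem theorem5p8:
  fixes m :: nat
    and r :: real
    and A :: "nat \<Rightarrow> real ^ ('n::{finite,linorder}) ^ ('n::{finite,linorder})"
    and d :: "nat \<Rightarrow> real ^ 'n::{finite,linorder}"
    and S :: "nat \<Rightarrow> real ^ 'n::{finite,linorder} \<Rightarrow> real ^ 'n::{finite,linorder}"
    and p :: "nat \<Rightarrow> real"
    and K :: "(real ^ 'n::{finite,linorder}) set"
    and \<mu> :: "(real ^ 'n::{finite,linorder}) measure"
  assumes r: "0 < r" "r < 1"
    and A: "\<And>i. i \<le> m \<Longrightarrow> orthogonal_matrix (A i)"
    and S: "\<And>i x. i \<le> m \<Longrightarrow> S i x = r *\<^sub>R (A i *v x) + d i"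
    and K: "is_attractor m S K"
    and p: "\<And>i. i \<le> m \<Longrightarrow> 0 < p i" "(\<Sum>i\<le>m. p i) = 1"
    and \<mu>: "is_self_similar_measure m S p \<mu>"
    and std: "standard_technical_assumptions m S p K"
  shows "\<exists>!C. essential_class (graph_verts m S K) (graph_edges m S K) C"
proof -
  have KQ: "K = Qcube" and fin: "finite (graph_verts m S Qcube)"
    using std by (auto simp: standard_technical_assumptions_def finite_neighbor_condition_def
        graph_verts_def)
  \<comment> \<open>Orthogonal matrices preserve norms, so distances scale by exactly
    \<open>r\<close>; they are also invertible, which gives surjectivity.\<close>
  have "similitude r (S i)" if i: "i \<le> m" for i
  proof -
    have o: "orthogonal_transformation ((*v) (A i))"
      using A[OF i] by (simp add: orthogonal_transformation_matrix)
    have "dist (S i x) (S i y) = r * dist x y" for x y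
    proof -
      have "S i x - S i y = r *\<^sub>R (A i *v (x - y))"
        by (simp add: S[OF i] matrix_vector_mult_diff_distrib scaleR_diff_right)
      then show ?thesis
        using orthogonal_transformation_norm[OF o] r by (simp add: dist_norm)
    qed
    moreover have "surj (S i)"
    proof (rule surjI)
      fix y
      have "surj ((*v) (A i))" using orthogonal_transformation_surj[OF o] .
      then show "S i (inv ((*v) (A i)) ((1 / r) *\<^sub>R (y - d i))) = y"
        using r by (simp add: S[OF i] surj_f_inv_f)
    qed
    ultimately show ?thesis using r by (simp add: similitude_def)
  qed
  moreover have "Qcube = (\<Union>i\<le>m. S i ` Qcube)" using K KQ by (simp add: is_attractor_def)
  ultimately interpret cube_ifs m r S using r by unfold_locales auto
  show ?thesis unfolding KQ by (rule ex1_essential_class_net_intervals[OF fin])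
qed

end
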